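(* Let $A$ be a linear operator in $\mathbb{F}^d$, and let $W$ be the one-dimensional subspace of $\mathbb{F}^d$ spanned by a unit vector $\omega_1\in\mathbb{F}^d\setminus\{\mathbf{0}\}$. Then there exists a single vector $b\in\mathbb{F}^d$ that is complete (i.e. $\{b\}$ is a complete set) for the source recovery problem (for $A$ and $W$) if and only if $$\omega_1\notin\ker\big((A^*-I)^d\big)\cap(\ker(A-I))^\perp=\big(\mathrm{Range}((A-I)^d)\big)^\perp\cap(\ker(A-I))^\perp.$$
   Context: $\mathbb{F}$ is $\mathbb{R}$ or $\mathbb{C}$, and $\langle x,y\rangle=y^*x$ is the canonical inner product on $\mathbb{F}^d$; $A^*$ is the adjoint of $A$ and $\perp$ denotes orthogonal complement. Source recovery problem: given $A$, a subspace $W\subseteq\mathbb{F}^d$ and vectors $b_1,\dots,b_L\in\mathbb{F}^d$ (called spatial observational vectors), consider the dynamics $x(n+1)=A^*x(n)+\omega$, $n\in\mathbb{N}_0$, $x(0)=x_0$, where the constant source $\omega\in W$ and the initial state $x_0\in\mathbb{F}^d$ are unknown, with measurements $y_\ell(n)=\langle x(n),b_\ell\rangle$, $1\le\ell\le L$. The set $\{b_1,\dots,b_L\}$ is complete if every $\omega\in W$ can be recovered, regardless of $x_0$, by finitely many linear operations from finitely many measurements; that is, there exist $T\in\mathbb{N}_0$ and vectors $u_{n,\ell}\in\mathbb{F}^d$ ($0\le n\le T$, $1\le\ell\le L$) such that $\omega=\sum_{n,\ell}y_\ell(n)\,u_{n,\ell}$ for all $x_0\in\mathbb{F}^d$ and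 all $\omega\in W$. *)

theory Defs
  imports "HOL-Analysis.Analysis" "Jordan_Normal_Form.Conjugate"
begin

text \<open>
  Everything is developed for vectors over a field with a conjugation, so that the cases of real
  scalars (trivial conjugation) and complex scalars (conjugation \<open>cnj\<close>) share the same definitions.
\<close>

definition hinner :: "'k::conjugatable_field ^ 'n \<Rightarrow> 'k ^ 'n \<Rightarrow> 'k" where
  "hinner x y = (\<Sum>i\<in>UNIV. conjugate (y $ i) * x $ i)"

lemma hinner_real: "hinner x y = x \<bullet> y" for x y :: "real ^ 'n"
  by (simp add: hinner_def inner_vec_def mult.commute)

lemma hinner_complex: "hinner x y = (\<Sum>i\<in>UNIV. cnj (y $ i) * x $ i)" for x y :: "complex ^ 'n"
  by (simp add: hinner_def)

text \<open>
  The library constant \<open>adjoint\<close> refers to the real inner product, hence does not apply to the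
  complex case. The description below is well defined for every linear operator, see
  \<open>hadjoint_works\<close>.
\<close>

definition hadjoint ::
  "('k::conjugatable_field ^ 'n \<Rightarrow> 'k ^ 'n) \<Rightarrow> 'k ^ 'n \<Rightarrow> 'k ^ 'n" where
  "hadjoint A = (THE B. \<forall>x y. hinner (A x) y = hinner x (B y))"

lemma hadjoint_unique:
  assumes "\<forall>x y. hinner (A x) y = hinner x (B y)" "\<forall>x y. hinner (A x) y = hinner x (C y)"
  shows "B = C"
proof
  fix y
  have *: "hinner (axis i 1) z = conjugate (z $ i)" for i and z :: "'a ^ 'b"
    by (simp add: hinner_def axis_def if_distrib cong: if_cong)
  have "hinner (axis i 1) (B y) = hinner (axis i 1) (C y)" for i
    using assms by simp
  then have "B y $ i = C y $ i" for i
    by (simp add: *)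
  then show "B y = C y"
    by (simp add: vec_eq_iff)
qed

lemma hadjoint_works:
  fixes A :: "'k::conjugatable_field ^ 'n \<Rightarrow> 'k ^ 'n"
  assumes "Vector_Spaces.linear (*s) (*s) A"
  shows "hinner (A x) y = hinner x (hadjoint A y)"
proof -
  define B where "B y = (\<chi> j. \<Sum>i\<in>UNIV. conjugate (matrix A $ i $ j) * y $ i)" for y
  have "hinner (A x) y = hinner x (B y)" for x y
  proof -
    have "A x = matrix A *v x"
      by (simp add: matrix_works[OF assms])
    then have "hinner (A x) y =
        (\<Sum>i\<in>UNIV. \<Sum>j\<in>UNIV. conjugate (y $ i) * (matrix A $ i $ j * x $ j))"
      by (simp add: hinner_def matrix_vector_mult_def sum_distrib_left)
    also have "\<dots> = (\<Sum>j\<in>UNIV. \<Sum>i\<in>UNIV. conjugate (y $ i) * (matrix A $ i $ j * x $ j))"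
      by (rule sum.swap)
    also have "\<dots> = hinner x (B y)"
      by (simp add: hinner_def B_def sum_conjugate conjugate_dist_mul sum_distrib_left
          sum_distrib_right mult_ac)
    finally show ?thesis .
  qed
  then have B: "\<forall>x y. hinner (A x) y = hinner x (B y)"
    by blast
  have "\<exists>!B. \<forall>x y. hinner (A x) y = hinner x (B y)"
  proof (rule ex1I[where a = B])
    show "\<forall>x y. hinner (A x) y = hinner x (B y)" by (fact B)
  next
    fix C assume "\<forall>x y. hinner (A x) y = hinner x (C y)"
    then show "C = B" by (rule hadjoint_unique[OF _ B])
  qed
  then have "\<forall>x y. hinner (A x) y = hinner x (hadjoint A y)"
    unfolding hadjoint_def by (rule theI')
  then show ?thesis by blast
qed

definition op_ker :: "('a \<Rightarrow> 'b::zero) \<Rightarrow> 'a set" where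
  "op_ker f = {x. f x = 0}"

definition hperp :: "('k::conjugatable_field ^ 'n) set \<Rightarrow> ('k ^ 'n) set" where
  "hperp S = {x. \<forall>y\<in>S. hinner x y = 0}"

primrec source_state ::
  "('k::conjugatable_field ^ 'n \<Rightarrow> 'k ^ 'n) \<Rightarrow> 'k ^ 'n \<Rightarrow> 'k ^ 'n \<Rightarrow> nat \<Rightarrow> 'k ^ 'n" where
  "source_state A x0 \<omega> 0 = x0"
| "source_state A x0 \<omega> (Suc n) = hadjoint A (source_state A x0 \<omega> n) + \<omega>"

text \<open>
  The finite family of spatial observational vectors is given as a finite set, so the measurements
  and the recovery vectors are indexed by the observational vectors themselves. The horizon \<open>T\<close> and
  the vectors \<open>u\<close> must not depend on the initial state or on the source.
\<close>

definition source_complete ::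
  "('k::conjugatable_field ^ 'n \<Rightarrow> 'k ^ 'n) \<Rightarrow> ('k ^ 'n) set \<Rightarrow> ('k ^ 'n) set \<Rightarrow> bool" where
  "source_complete A W B \<longleftrightarrow> finite B \<and>
    (\<exists>(T::nat) (u :: nat \<Rightarrow> 'k ^ 'n \<Rightarrow> 'k ^ 'n). \<forall>x0. \<forall>\<omega>\<in>W.
      \<omega> = (\<Sum>n\<le>T. \<Sum>b\<in>B. hinner (source_state A x0 \<omega> n) b *s u n b))"

end

theory Submission
  imports Defs
begin

text \<open>
  Write \<open>D = A - I\<close> and \<open>N = CARD('n)\<close>. A finite combination of the measurements is a functional
  \<open>\<langle>x0, x\<rangle> + \<langle>\<omega>, z\<rangle>\<close> with \<open>x = c b + D z\<close> and \<open>z\<close> in the \<open>A\<close>-cyclic span \<open>V\<close> of \<open>b\<close>; completeness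
  means that some such pair has \<open>x = 0\<close> and \<open>\<langle>\<omega>1, z\<rangle> \<noteq> 0\<close>. If \<open>c = 0\<close>, then \<open>z\<close> is in the kernel
  of \<open>D\<close>; otherwise \<open>b \<in> D V\<close>, so \<open>V \<subseteq> D V\<close> and \<open>z\<close> is in the range of \<open>D ^ N\<close>. Conversely, for
  \<open>z\<close> in the kernel of \<open>D\<close> the choice \<open>b = z\<close> works. For \<open>z\<close> in the range of \<open>D ^ N\<close> the choice
  \<open>b = D z\<close> works, because the \<open>D\<close>-cyclic spans of \<open>z\<close> and \<open>D z\<close> agree.
\<close>

section \<open>The sesquilinear form\<close>

lemma hinner_add_left: "hinner (x + y) z = hinner x z + hinner y z"
  by (simp add: hinner_def algebra_simps sum.distrib)

lemma hinner_add_right: "hinner x (y + z) = hinner x y + hinner x z"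
  by (simp add: hinner_def algebra_simps sum.distrib conjugate_dist_add)

lemma hinner_scale_left: "hinner (c *s x) y = c * hinner x y"
  by (simp add: hinner_def sum_distrib_left mult_ac)

lemma hinner_scale_right: "hinner x (c *s y) = conjugate c * hinner x y"
  by (simp add: hinner_def sum_distrib_left conjugate_dist_mul mult_ac)

lemma hinner_zero_left [simp]: "hinner 0 x = 0"
  and hinner_zero_right [simp]: "hinner x 0 = 0"
  by (simp_all add: hinner_def)

lemma hinner_diff_left: "hinner (x - y) z = hinner x z - hinner y z"
  by (metis add_diff_cancel_right' diff_add_cancel hinner_add_left)

lemma hinner_diff_right: "hinner x (y - z) = hinner x y - hinner x z"
  by (metis add_diff_cancel_right' diff_add_cancel hinner_add_right)

lemma hinner_sum_right: "hinner x (\<Sum>i\<in>I. f i) = (\<Sum>i\<in>I. hinner x (f i))"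
  by (induction I rule: infinite_finite_induct) (simp_all add: hinner_add_right)

lemma hinner_commute: "hinner x y = conjugate (hinner y x)"
  by (simp add: hinner_def sum_conjugate conjugate_dist_mul mult.commute)

lemma conjugate_one: "conjugate (1 :: 'k::conjugatable_field) = 1"
  by (metis conjugate_dist_mul conjugate_id mult_1_left mult_1_right)

lemma hinner_axis_right: "hinner x (axis i 1) = x $ i"
proof -
  have "hinner x (axis i 1) = (\<Sum>j\<in>UNIV. if j = i then x $ j else 0)"
    unfolding hinner_def by (rule sum.cong) (auto simp: axis_def conjugate_one)
  then show ?thesis by simp
qed

lemma hinner_eq_zero_left_iff: "(\<forall>y. hinner x y = 0) \<longleftrightarrow> x = 0"
  by (metis hinner_axis_right hinner_zero_left vec_eq_iff zero_index)

lemma hinner_eq_zero_right_iff: "(\<forall>x. hinner x y = 0) \<longleftrightarrow> y = 0"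
  by (metis hinner_eq_zero_left_iff hinner_commute conjugate_zero)

lemma hadjoint_left:
  assumes "Vector_Spaces.linear (*s) (*s) A"
  shows "hinner (hadjoint A x) y = hinner x (A y)"
  by (metis assms hadjoint_works hinner_commute)

lemma hinner_funpow_adjoint:
  fixes B D :: "'k::conjugatable_field ^ 'n \<Rightarrow> 'k ^ 'n"
  assumes "\<And>x y. hinner (B x) y = hinner x (D y)"
  shows "hinner ((B ^^ n) x) y = hinner x ((D ^^ n) y)"
proof (induction n arbitrary: y)
  case (Suc n)
  have "hinner ((B ^^ Suc n) x) y = hinner x ((D ^^ n) (D y))"
    using assms Suc by simp
  then show ?case
    by (simp add: funpow_swap1)
qed simp

text \<open>By nondegeneracy, \<open>B x = 0\<close> can be tested against all \<open>y\<close>; the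
  adjoint relation turns this into testing \<open>x\<close> against all \<open>D y\<close>.\<close>

lemma op_ker_adjoint_eq_hperp_range:
  assumes "\<And>x y. hinner (B x) y = hinner x (D y)"
  shows "op_ker B = hperp (range D)"
  unfolding op_ker_def hperp_def by (simp add: assms flip: hinner_eq_zero_left_iff)

section \<open>Cyclic subspaces of a linear operator\<close>

lemma linear_funpow:
  fixes D :: "'k::field ^ 'n \<Rightarrow> 'k ^ 'n"
  assumes "Vector_Spaces.linear (*s) (*s) D"
  shows "Vector_Spaces.linear (*s) (*s) (D ^^ n)"
proof (induction n)
  case 0
  show ?case using vec.linear_id by (simp add: id_def)
next
  case (Suc n)
  then show ?case
    using Vector_Spaces.linear_compose[OF Suc assms] by (simp add: comp_def)
qed

lemma antimono_nat_stationary: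
  fixes f :: "nat \<Rightarrow> nat"
  assumes "\<And>k. f (Suc k) \<le> f k" and "f 0 \<le> N"
  shows "\<exists>k\<le>N. f (Suc k) = f k"
proof (rule ccontr)
  assume "\<not> ?thesis"
  then have less: "f (Suc k) < f k" if "k \<le> N" for k
    using assms(1) le_neq_implies_less that by blast
  have "f k + k \<le> N" if "k \<le> Suc N" for k
    using that
  proof (induction k)
    case (Suc k)
    then show ?case using less[of k] by simp
  qed (use assms in simp)
  from this[of "Suc N"] show False by simp
qed

text \<open>The images of \<open>X\<close> under powers of \<open>D\<close> form a decreasing chain
  of subspaces whose dimensions start at most at \<open>CARD('n)\<close>. Two consecutive ones
  therefore agree at some index up to \<open>CARD('n)\<close>.\<close>

lemma funpow_image_subspace_stable:
  fixes D :: "'k::field ^ 'n \<Rightarrow> 'k ^ 'n"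
  assumes D: "Vector_Spaces.linear (*s) (*s) D"
    and X: "vec.subspace X" and inv: "D ` X \<subseteq> X"
  shows "(D ^^ CARD('n)) ` X = (D ^^ Suc CARD('n)) ` X"
proof -
  have sub: "vec.subspace ((D ^^ k) ` X)" for k
    by (rule vec.linear_subspace_image[OF linear_funpow[OF D] X])
  have Suc_image: "(D ^^ Suc k) ` X = D ` (D ^^ k) ` X" for k
    by (simp add: image_comp)
  have dec: "(D ^^ Suc k) ` X \<subseteq> (D ^^ k) ` X" for k
  proof -
    have "(D ^^ Suc k) ` X = (D ^^ k) ` D ` X"
      by (simp add: image_comp funpow_Suc_right del: funpow.simps)
    then show ?thesis using inv by blast
  qed
  obtain k where k: "k \<le> CARD('n)"
    and dim: "vec.dim ((D ^^ Suc k) ` X) = vec.dim ((D ^^ k) ` X)"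
    using antimono_nat_stationary[of "\<lambda>k. vec.dim ((D ^^ k) ` X)" "CARD('n)"]
      vec.dim_subset[OF dec] vec.dim_subset_UNIV[of "(D ^^ 0) ` X"]
    by (auto simp: vec.dimension_def card_cart_basis simp del: funpow.simps)
  have "(D ^^ Suc k) ` X = (D ^^ k) ` X"
    using vec.subspace_dim_equal[OF sub sub dec] dim by simp
  \<comment> \<open>Applying \<open>D\<close> to an equality in the chain gives the next one, so the
    chain stays constant from \<open>k\<close> on, in particular at \<open>CARD('n)\<close>.\<close>
  then have "(D ^^ Suc (k + j)) ` X = (D ^^ (k + j)) ` X" for j
    by (induction j) (simp_all only: add_Suc_right add_0_right Suc_image)
  from this[of "CARD('n) - k"] k show ?thesis by simp
qed

lemma image_cyclic_span_subset:
  fixes D :: "'k::field ^ 'n \<Rightarrow> 'k ^ 'n"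
  assumes D: "Vector_Spaces.linear (*s) (*s) D"
  shows "D ` vec.span (range (\<lambda>j. (D ^^ j) w)) \<subseteq> vec.span (range (\<lambda>j. (D ^^ j) w))"
  unfolding vec.linear_span_image[OF D, symmetric]
  by (rule vec.span_mono) (auto intro: range_eqI[where x = "Suc _"])

text \<open>Stabilization is applied to the cyclic span \<open>X\<close> of \<open>w\<close>: the
  next image of \<open>X\<close> still contains this vector, and that image is the cyclic span of
  \<open>(D ^^ Suc CARD('n)) w\<close>.\<close>

lemma funpow_card_in_cyclic_span:
  fixes D :: "'k::field ^ 'n \<Rightarrow> 'k ^ 'n"
  assumes D: "Vector_Spaces.linear (*s) (*s) D"
  shows "(D ^^ CARD('n)) w \<in> vec.span (range (\<lambda>j. (D ^^ j) ((D ^^ Suc CARD('n)) w)))"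
proof -
  define X where "X = vec.span (range (\<lambda>j. (D ^^ j) w))"
  have inv: "D ` X \<subseteq> X"
    unfolding X_def by (rule image_cyclic_span_subset[OF D])
  have "(D ^^ 0) w \<in> X"
    unfolding X_def by (rule vec.span_base) blast
  then have "(D ^^ CARD('n)) w \<in> (D ^^ Suc CARD('n)) ` X"
    using funpow_image_subspace_stable[OF D _ inv] by (auto simp: X_def)
  also have "\<dots> = vec.span ((D ^^ Suc CARD('n)) ` range (\<lambda>j. (D ^^ j) w))"
    unfolding X_def by (rule vec.linear_span_image[OF linear_funpow[OF D], symmetric])
  also have "(D ^^ Suc CARD('n)) ` range (\<lambda>j. (D ^^ j) w) =
      range (\<lambda>j. (D ^^ j) ((D ^^ Suc CARD('n)) w))"
    by (simp only: image_image flip: o_apply[of "D ^^ _" "D ^^ _"] funpow_add add.commute)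
  finally show ?thesis .
qed

lemma subset_image_imp_subset_range_funpow:
  assumes "V \<subseteq> D ` V"
  shows "V \<subseteq> range (D ^^ n)"
proof -
  have "V \<subseteq> (D ^^ n) ` V"
  proof (induction n)
    case (Suc n)
    have "V \<subseteq> D ` V" by (fact assms)
    also have "\<dots> \<subseteq> D ` (D ^^ n) ` V" using Suc by blast
    finally show ?case by (simp add: image_comp)
  qed simp
  then show ?thesis by blast
qed

text \<open>Since \<open>A\<close> and \<open>D\<close> commute, the image of the cyclic span
  \<open>V\<close> under \<open>D\<close> is an \<open>A\<close>-invariant subspace. It contains
  \<open>b\<close>, hence all of \<open>V\<close>, and \<open>V\<close> lies in its own
  image.\<close>

lemma cyclic_span_subset_range_funpow:
  fixes A :: "'k::field ^ 'n \<Rightarrow> 'k ^ 'n"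
  assumes A: "Vector_Spaces.linear (*s) (*s) A"
    and D: "Vector_Spaces.linear (*s) (*s) D"
    and comm: "\<And>x. A (D x) = D (A x)"
    and b: "b \<in> D ` vec.span (range (\<lambda>j. (A ^^ j) b))"
  shows "vec.span (range (\<lambda>j. (A ^^ j) b)) \<subseteq> range (D ^^ n)"
proof (rule subset_image_imp_subset_range_funpow)
  define V where "V = vec.span (range (\<lambda>j. (A ^^ j) b))"
  have inv: "A ` V \<subseteq> V"
    unfolding V_def by (rule image_cyclic_span_subset[OF A])
  have "(A ^^ j) b \<in> D ` V" for j
  proof (induction j)
    case 0
    show ?case using b by (simp add: V_def)
  next
    case (Suc j)
    then show ?case using inv comm by auto
  qed
  moreover have "vec.subspace (D ` V)"
    unfolding V_def by (rule vec.linear_subspace_image[OF D vec.subspace_span])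
  ultimately show "V \<subseteq> D ` V"
    unfolding V_def by (intro vec.span_minimal) auto
qed

section \<open>Combinations of measurements\<close>

text \<open>Peels off the first step instead of the last: the dynamics are autonomous, so a delay
  only changes the initial state.\<close>

lemma source_state_Suc_shift:
  "source_state A x0 \<omega> (Suc n) = source_state A (hadjoint A x0 + \<omega>) \<omega> n"
  by (induction n) simp_all

text \<open>The functionals of initial state and source that are finite combinations of
  measurements, encoded by their representing vectors. The source ranges over the whole space
  here.\<close>

definition obs_pairs ::
  "('k::conjugatable_field ^ 'n \<Rightarrow> 'k ^ 'n) \<Rightarrow> 'k ^ 'n \<Rightarrow> (('k ^ 'n) \<times> ('k ^ 'n)) set" where
  "obs_pairs A b = {(x, z). \<exists>T a. \<forall>x0 \<omega>.
     (\<Sum>n<T. a n * hinner (source_state A x0 \<omega> n) b) = hinner x0 x + hinner \<omega> z}"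

lemma obs_pairs_base: "(b, 0) \<in> obs_pairs A b"
  unfolding obs_pairs_def by (auto intro!: exI[of _ "Suc 0"] exI[of _ "\<lambda>_. 1"])

lemma obs_pairs_add:
  assumes "(x, z) \<in> obs_pairs A b" "(x', z') \<in> obs_pairs A b"
  shows "(x + x', z + z') \<in> obs_pairs A b"
proof -
  obtain T a T' a' where
    a: "\<And>x0 \<omega>. (\<Sum>n<T. a n * hinner (source_state A x0 \<omega> n) b) = hinner x0 x + hinner \<omega> z" and
    a': "\<And>x0 \<omega>. (\<Sum>n<T'. a' n * hinner (source_state A x0 \<omega> n) b) = hinner x0 x' + hinner \<omega> z'"
    using assms by (auto simp: obs_pairs_def)
  \<comment> \<open>Padding with zero coefficients brings both combinations to a common
    horizon.\<close>
  have pad: "(\<Sum>n<max T T'. (if n < S then c n else 0) * g n) = (\<Sum>n<S. c n * g n)"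
    if "S \<le> max T T'" for S and c g :: "nat \<Rightarrow> 'a"
    using that by (intro sum.mono_neutral_cong_right) auto
  show ?thesis
    unfolding obs_pairs_def
    by (auto intro!: exI[of _ "max T T'"]
        exI[of _ "\<lambda>n. (if n < T then a n else 0) + (if n < T' then a' n else 0)"]
        simp: distrib_right sum.distrib pad a a' hinner_add_right)
qed

lemma obs_pairs_scale:
  assumes "(x, z) \<in> obs_pairs A b"
  shows "(c *s x, c *s z) \<in> obs_pairs A b"
proof -
  obtain T a where
    a: "\<And>x0 \<omega>. (\<Sum>n<T. a n * hinner (source_state A x0 \<omega> n) b) = hinner x0 x + hinner \<omega> z"
    using assms by (auto simp: obs_pairs_def)
  \<comment> \<open>The form is conjugate-linear in its second argument, so the coefficients are
    scaled by the conjugate.\<close>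
  have "\<forall>x0 \<omega>. (\<Sum>n<T. (conjugate c * a n) * hinner (source_state A x0 \<omega> n) b) =
      hinner x0 (c *s x) + hinner \<omega> (c *s z)"
    by (simp add: mult.assoc a hinner_scale_right distrib_left flip: sum_distrib_left)
  then show ?thesis
    unfolding obs_pairs_def mem_Collect_eq case_prod_conv by (intro exI)
qed

lemma obs_pairs_diff:
  assumes "(x, z) \<in> obs_pairs A b" "(x', z') \<in> obs_pairs A b"
  shows "(x - x', z - z') \<in> obs_pairs A b"
  using obs_pairs_add[OF assms(1) obs_pairs_scale[OF assms(2), of "-1"]] by simp

text \<open>Delaying all measurements by one step replaces \<open>x0\<close> by
  \<open>hadjoint A x0 + \<omega>\<close>; pairing this with \<open>x\<close> contributes
  \<open>A x\<close> to the state part and \<open>x\<close> to the source part.\<close>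

lemma obs_pairs_shift:
  assumes A: "Vector_Spaces.linear (*s) (*s) A"
    and "(x, z) \<in> obs_pairs A b"
  shows "(A x, x + z) \<in> obs_pairs A b"
proof -
  obtain T a where
    a: "\<And>x0 \<omega>. (\<Sum>n<T. a n * hinner (source_state A x0 \<omega> n) b) = hinner x0 x + hinner \<omega> z"
    using assms by (auto simp: obs_pairs_def)
  define a' where "a' n = (case n of 0 \<Rightarrow> 0 | Suc m \<Rightarrow> a m)" for n
  have "(\<Sum>n<Suc T. a' n * hinner (source_state A x0 \<omega> n) b) =
      hinner x0 (A x) + hinner \<omega> (x + z)" for x0 \<omega>
  proof -
    have "(\<Sum>n<Suc T. a' n * hinner (source_state A x0 \<omega> n) b) =
        (\<Sum>n<T. a n * hinner (source_state A (hadjoint A x0 + \<omega>) \<omega> n) b)"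
      unfolding sum.lessThan_Suc_shift source_state_Suc_shift by (simp add: a'_def)
    then show ?thesis
      by (simp add: a hinner_add_left hinner_add_right hadjoint_left[OF A] add_ac)
  qed
  then show ?thesis
    unfolding obs_pairs_def by blast
qed

lemma obs_pairs_shift_diff:
  assumes "Vector_Spaces.linear (*s) (*s) A"
    and "(x, z) \<in> obs_pairs A b"
  shows "(A x - x, x) \<in> obs_pairs A b"
  using obs_pairs_diff[OF obs_pairs_shift[OF assms] assms(2)] by simp

lemma obs_pairs_cyclic:
  fixes A :: "'k::conjugatable_field ^ 'n \<Rightarrow> 'k ^ 'n"
  assumes A: "Vector_Spaces.linear (*s) (*s) A"
    and z: "z \<in> vec.span (range (\<lambda>j. ((\<lambda>x. A x - x) ^^ j) b))"
  shows "(A z - z, z) \<in> obs_pairs A b"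
proof -
  interpret A: Vector_Spaces.linear "(*s)" "(*s)" A by (fact A)
  have gen: "(A ((D ^^ j) b) - (D ^^ j) b, (D ^^ j) b) \<in> obs_pairs A b"
    if "D = (\<lambda>x. A x - x)" for D j
  proof (induction j)
    case 0
    show ?case using obs_pairs_shift_diff[OF A obs_pairs_base] by simp
  next
    case (Suc j)
    show ?case using obs_pairs_shift_diff[OF A Suc] by (simp add: that)
  qed
  \<comment> \<open>This subspace contains every generator: \<open>(b, 0)\<close> yields
    \<open>b\<close>, and the difference of a pair and its shift passes from each iterate to the
    next.\<close>
  let ?Z = "{z. (A z - z, z) \<in> obs_pairs A b}"
  have "vec.subspace ?Z"
  proof (rule vec.subspaceI)
    show "0 \<in> ?Z"
      using obs_pairs_scale[OF obs_pairs_base, of 0 b A] by (simp add: A.zero)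
  next
    fix x y assume "x \<in> ?Z" "y \<in> ?Z"
    then show "x + y \<in> ?Z"
      using obs_pairs_add[of "A x - x" x A b "A y - y" y] by (simp add: A.add algebra_simps)
  next
    fix c x assume "x \<in> ?Z"
    then show "c *s x \<in> ?Z"
      using obs_pairs_scale[of "A x - x" x A b c]
      by (simp add: A.scale vec.scale_right_diff_distrib)
  qed
  then show ?thesis
    using vec.span_minimal[of "range (\<lambda>j. ((\<lambda>x. A x - x) ^^ j) b)" ?Z] gen z by blast
qed

text \<open>The witness is the geometric sum of \<open>(A ^^ j) b\<close> over \<open>j < n\<close>,
  built by replacing \<open>z\<close> with \<open>b + A z\<close>. Telescoping makes
  \<open>b + (A z - z)\<close> equal to \<open>(A ^^ n) b\<close>.\<close>

lemma measurement_eq: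
  fixes A :: "'k::conjugatable_field ^ 'n \<Rightarrow> 'k ^ 'n"
  assumes A: "Vector_Spaces.linear (*s) (*s) A"
  shows "\<exists>z\<in>vec.span (range (\<lambda>j. (A ^^ j) b)). \<forall>x0 \<omega>.
    hinner (source_state A x0 \<omega> n) b = hinner x0 (b + (A z - z)) + hinner \<omega> z"
proof (induction n)
  case 0
  interpret A: Vector_Spaces.linear "(*s)" "(*s)" A by (fact A)
  show ?case by (rule bexI[of _ 0]) (simp_all add: A.zero vec.span_zero)
next
  case (Suc n)
  interpret A: Vector_Spaces.linear "(*s)" "(*s)" A by (fact A)
  define V where "V = vec.span (range (\<lambda>j. (A ^^ j) b))"
  obtain z where z: "z \<in> V" and eq:
    "\<And>x0 \<omega>. hinner (source_state A x0 \<omega> n) b = hinner x0 (b + (A z - z)) + hinner \<omega> z"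
    using Suc by (auto simp: V_def)
  have inv: "A ` V \<subseteq> V"
    unfolding V_def by (rule image_cyclic_span_subset[OF A])
  have "b \<in> V"
    unfolding V_def by (rule vec.span_base) (auto intro: range_eqI[where x = 0])
  then have "b + A z \<in> V"
    using inv z unfolding V_def by (intro vec.span_add) auto
  moreover have "hinner (source_state A x0 \<omega> (Suc n)) b =
      hinner x0 (b + (A (b + A z) - (b + A z))) + hinner \<omega> (b + A z)" for x0 \<omega>
    unfolding source_state_Suc_shift eq
    by (simp add: hinner_add_left hinner_add_right hinner_diff_right hadjoint_left[OF A]
        A.add A.diff algebra_simps)
  ultimately show ?case
    unfolding V_def by blast
qed

section \<open>Completeness of a single vector\<close>

text \<open>Such a pair reads off \<open>hinner \<omega> z\<close> independently of
  \<open>x0\<close>. For a source \<open>c *s w\<close> this is \<open>c * hinner w z\<close>, and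
  division recovers \<open>c\<close>.\<close>

lemma source_complete_if_obs_pair:
  assumes "(0, z) \<in> obs_pairs A b" and nz: "hinner w z \<noteq> 0"
  shows "source_complete A (vec.span {w}) {b}"
proof -
  obtain T a where
    a: "\<And>x0 \<omega>. (\<Sum>n<T. a n * hinner (source_state A x0 \<omega> n) b) = hinner \<omega> z"
    using assms by (auto simp: obs_pairs_def)
  \<comment> \<open>The recovery sum includes time \<open>T\<close> while the combination stops
    before it, hence the default 0.\<close>
  define u where "u n = (if n < T then (a n / hinner w z) *s w else 0)" for n
  have "c *s w = (\<Sum>n\<le>T. \<Sum>b\<in>{b}. hinner (source_state A x0 (c *s w) n) b *s u n)" for x0 c
  proof -
    let ?y = "\<lambda>n. hinner (source_state A x0 (c *s w) n) b"
    have "(\<Sum>n\<le>T. ?y n *s u n) = (\<Sum>n<T. (a n * ?y n / hinner w z) *s w)"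
      by (rule sum.mono_neutral_cong_right) (auto simp: u_def mult.commute)
    also have "\<dots> = ((\<Sum>n<T. a n * ?y n) / hinner w z) *s w"
      by (simp add: vec.scale_sum_left sum_divide_distrib)
    also have "\<dots> = c *s w"
      using nz by (simp add: a hinner_scale_left)
    finally show ?thesis by simp
  qed
  then have "\<forall>x0. \<forall>\<omega>\<in>vec.span {w}.
      \<omega> = (\<Sum>n\<le>T. \<Sum>b\<in>{b}. hinner (source_state A x0 \<omega> n) b *s u n)"
    by (auto simp: vec.span_singleton)
  then show ?thesis
    unfolding source_complete_def by (intro conjI exI[of _ T] exI[of _ "\<lambda>n b. u n"]) auto
qed

lemma not_perp_if_source_complete:
  fixes A :: "'k::conjugatable_field ^ 'n \<Rightarrow> 'k ^ 'n"
  assumes A: "Vector_Spaces.linear (*s) (*s) A" and "w \<noteq> 0"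
    and "source_complete A (vec.span {w}) {b}"
  shows "w \<notin> hperp (range ((\<lambda>x. A x - x) ^^ m)) \<inter> hperp (op_ker (\<lambda>x. A x - x))"
proof -
  define D where "D = (\<lambda>x. A x - x)"
  define V where "V = vec.span (range (\<lambda>j. (A ^^ j) b))"
  have D: "Vector_Spaces.linear (*s) (*s) D"
    unfolding D_def by (rule vec.linear_compose_sub[OF A vec.linear_ident])
  interpret A: Vector_Spaces.linear "(*s)" "(*s)" A by (fact A)
  interpret D: Vector_Spaces.linear "(*s)" "(*s)" D by (fact D)
  \<comment> \<open>Reading the recovery formula at a nonzero coordinate of \<open>w\<close> turns
    it into one scalar combination of measurements.\<close>
  obtain i where i: "w $ i \<noteq> 0"
    using \<open>w \<noteq> 0\<close> by (auto simp: vec_eq_iff)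
  obtain T u where u: "\<And>x0 \<omega>. \<omega> \<in> vec.span {w} \<Longrightarrow>
      \<omega> = (\<Sum>n\<le>T. hinner (source_state A x0 \<omega> n) b *s u n b)"
    using assms(3) by (auto simp: source_complete_def)
  obtain \<zeta> where \<zeta>V: "\<And>n. \<zeta> n \<in> V" and \<zeta>: "\<And>n x0 \<omega>.
      hinner (source_state A x0 \<omega> n) b = hinner x0 (b + D (\<zeta> n)) + hinner \<omega> (\<zeta> n)"
    using measurement_eq[OF A, of b] unfolding V_def D_def Bex_def by metis
  \<comment> \<open>Conjugated so that the coefficients can move into the second argument of
    \<open>hinner\<close>.\<close>
  define \<alpha> where "\<alpha> n = conjugate (u n b $ i)" for n
  define c where "c = (\<Sum>n\<le>T. \<alpha> n)"
  define z where "z = (\<Sum>n\<le>T. \<alpha> n *s \<zeta> n)"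
  have zV: "z \<in> V"
    unfolding z_def V_def by (intro vec.span_sum vec.span_scale) (use \<zeta>V in \<open>simp add: V_def\<close>)
  have key: "k * w $ i = hinner x0 (c *s b + D z) + k * hinner w z" for k x0
  proof -
    have "k *s w \<in> vec.span {w}"
      by (intro vec.span_scale vec.span_base) simp
    from arg_cong[OF u[OF this, of x0], of "\<lambda>v. v $ i"]
    have "k * w $ i = (\<Sum>n\<le>T. hinner (source_state A x0 (k *s w) n) b *s u n b) $ i"
      by (simp only: vector_smult_component)
    also have "\<dots> = (\<Sum>n\<le>T. hinner x0 (\<alpha> n *s b + D (\<alpha> n *s \<zeta> n)) + hinner (k *s w) (\<alpha> n *s \<zeta> n))"
      unfolding sum_component
      by (rule sum.cong)
         (simp_all add: \<zeta> \<alpha>_def D.scale hinner_add_right hinner_scale_right distrib_right mult.commute)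
    also have "\<dots> = hinner x0 (c *s b + D z) + hinner (k *s w) z"
      by (simp add: sum.distrib c_def z_def D.sum vec.scale_sum_left
          flip: hinner_sum_right)
    finally show ?thesis by (simp add: hinner_scale_left)
  qed
  \<comment> \<open>With zero source, the functional of \<open>x0\<close> vanishes
    identically.\<close>
  have x: "c *s b + D z = 0"
    using key[of 0] by (subst hinner_eq_zero_right_iff[symmetric]) simp
  \<comment> \<open>With source \<open>w\<close> and \<open>x0 = 0\<close>, this value equals
    \<open>w $ i\<close>.\<close>
  have wz: "hinner w z \<noteq> 0"
    using key[of 1 0] i by simp
  show ?thesis
  proof (cases "c = 0")
    case True
    then have "z \<in> op_ker D" using x by (simp add: op_ker_def)
    then show ?thesis using wz by (auto simp: hperp_def D_def)
  next
    case False
    have "D ((- inverse c) *s z) = b"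
    proof -
      have "D z = - (c *s b)"
        using x by (simp add: eq_neg_iff_add_eq_0 add.commute)
      then show ?thesis
        using False by (simp add: D.scale D.neg)
    qed
    moreover have "(- inverse c) *s z \<in> V"
      using zV unfolding V_def by (rule vec.span_scale)
    ultimately have "b \<in> D ` V" by blast
    then have "V \<subseteq> range (D ^^ m)"
      unfolding V_def by (rule cyclic_span_subset_range_funpow[OF A D, rotated])
        (simp add: D_def A.diff)
    then show ?thesis using zV wz by (auto simp: hperp_def D_def)
  qed
qed

lemma source_complete_if_not_perp:
  fixes A :: "'k::conjugatable_field ^ 'n \<Rightarrow> 'k ^ 'n"
  assumes A: "Vector_Spaces.linear (*s) (*s) A"
    and w: "w \<notin> hperp (range ((\<lambda>x. A x - x) ^^ CARD('n))) \<inter> hperp (op_ker (\<lambda>x. A x - x))"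
  shows "\<exists>b. source_complete A (vec.span {w}) {b}"
proof -
  define D where "D = (\<lambda>x. A x - x)"
  have D: "Vector_Spaces.linear (*s) (*s) D"
    unfolding D_def by (rule vec.linear_compose_sub[OF A vec.linear_ident])
  consider v where "D v = 0" "hinner w v \<noteq> 0"
    | x where "hinner w ((D ^^ CARD('n)) x) \<noteq> 0"
    using w by (auto simp: hperp_def op_ker_def D_def)
  then show ?thesis
  proof cases
    case (1 v)
    \<comment> \<open>With \<open>b = v\<close>, subtracting the measurement at time 0 from that at
      time 1 already gives \<open>(0, v)\<close>, as \<open>D v = 0\<close>.\<close>
    have "(D v, v) \<in> obs_pairs A v"
      using obs_pairs_shift_diff[OF A obs_pairs_base] by (simp add: D_def)
    then show ?thesis
      using 1 source_complete_if_obs_pair by metis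
  next
    case (2 x)
    define v where "v = (D ^^ CARD('n)) x"
    have "v \<in> vec.span (range (\<lambda>j. (D ^^ j) (D v)))"
      using funpow_card_in_cyclic_span[OF D, of x] by (simp add: v_def)
    then have "(D v, v) \<in> obs_pairs A (D v)"
      using obs_pairs_cyclic[OF A, of v "D v"] by (simp add: D_def)
    \<comment> \<open>As \<open>b = D v\<close>, the measurement at time 0 is the pair
      \<open>(D v, 0)\<close>, which cancels the state part.\<close>
    from obs_pairs_diff[OF this obs_pairs_base]
    have "(0, v) \<in> obs_pairs A (D v)" by simp
    then show ?thesis
      using 2 source_complete_if_obs_pair unfolding v_def by blast
  qed
qed

lemma ker_adjoint_power_eq_hperp_range:
  assumes "Vector_Spaces.linear (*s) (*s) A"
  shows "op_ker ((\<lambda>x. hadjoint A x - x) ^^ m) = hperp (range ((\<lambda>x. A x - x) ^^ m))"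
  by (intro op_ker_adjoint_eq_hperp_range hinner_funpow_adjoint)
     (simp add: hinner_diff_left hinner_diff_right hadjoint_left[OF assms])

text \<open>Working over any field with conjugation makes the real and complex cases instances of
  one equivalence.\<close>

lemma single_source_complete_iff:
  fixes A :: "'k::conjugatable_field ^ 'n \<Rightarrow> 'k ^ 'n"
  assumes A: "Vector_Spaces.linear (*s) (*s) A" and "w \<noteq> 0"
  shows "(\<exists>b. source_complete A (vec.span {w}) {b}) \<longleftrightarrow>
    w \<notin> op_ker ((\<lambda>x. hadjoint A x - x) ^^ CARD('n)) \<inter> hperp (op_ker (\<lambda>x. A x - x))"
  unfolding ker_adjoint_power_eq_hperp_range[OF A]
  using not_perp_if_source_complete[OF assms] source_complete_if_not_perp[OF A] by blast

theorem theorem2p14: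
  shows "(\<forall>(A :: real ^ 'n \<Rightarrow> real ^ 'n) (\<omega>\<^sub>1 :: real ^ 'n).
            Vector_Spaces.linear (*s) (*s) A \<and> norm \<omega>\<^sub>1 = 1 \<longrightarrow>
            ((\<exists>b. source_complete A (vec.span {\<omega>\<^sub>1}) {b}) \<longleftrightarrow>
              \<omega>\<^sub>1 \<notin> op_ker ((\<lambda>x. hadjoint A x - x) ^^ CARD('n)) \<inter> hperp (op_ker (\<lambda>x. A x - x))) \<and>
            op_ker ((\<lambda>x. hadjoint A x - x) ^^ CARD('n)) \<inter> hperp (op_ker (\<lambda>x. A x - x)) =
              hperp (range ((\<lambda>x. A x - x) ^^ CARD('n))) \<inter> hperp (op_ker (\<lambda>x. A x - x)))
       \<and> (\<forall>(A :: complex ^ 'n \<Rightarrow> complex ^ 'n) (\<omega>\<^sub>1 :: complex ^ 'n).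
            Vector_Spaces.linear (*s) (*s) A \<and> norm \<omega>\<^sub>1 = 1 \<longrightarrow>
            ((\<exists>b. source_complete A (vec.span {\<omega>\<^sub>1}) {b}) \<longleftrightarrow>
              \<omega>\<^sub>1 \<notin> op_ker ((\<lambda>x. hadjoint A x - x) ^^ CARD('n)) \<inter> hperp (op_ker (\<lambda>x. A x - x))) \<and>
            op_ker ((\<lambda>x. hadjoint A x - x) ^^ CARD('n)) \<inter> hperp (op_ker (\<lambda>x. A x - x)) =
              hperp (range ((\<lambda>x. A x - x) ^^ CARD('n))) \<inter> hperp (op_ker (\<lambda>x. A x - x)))"
proof -
  have nz: "w \<noteq> 0" if "norm w = 1" for w :: "'v::real_normed_vector"
    using that by auto
  show ?thesis
    by (intro conjI allI impI; elim conjE;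
        (rule single_source_complete_iff, assumption, erule nz |
         simp only: ker_adjoint_power_eq_hperp_range))
qed

end
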